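(* Suppose that: $\Omega\subset\mathbb{R}^n$ is a nonempty closed convex set; $F:\mathbb{R}^n\to\mathbb{R}^m$ is differentiable with $\|J_F(x)-J_F(y)\|_2\le L_J\|x-y\|_2$ for all $x,y\in\mathbb{R}^n$; $h:\mathbb{R}^m\to\mathbb{R}$ is convex with $|h(z)-h(w)|\le L_{h,p}\|z-w\|_p$ for all $z,w\in\mathbb{R}^m$; and there exists $f_{low}\in\mathbb{R}$ such that $f(x)=h(F(x))\ge f_{low}$ for all $x\in\mathbb{R}^n$. Let $\{x_k\}$ be generated by the algorithm TRFD (described in the context) with parameters $\epsilon,\sigma,\alpha,\theta,\Delta_0,\Delta_*$, let $$T_g(\epsilon)=\inf\{k\in\{0,1,2,\ldots\}:\psi_{p,\Delta_*}(x_k)\le\epsilon\},$$ and let $FE_{T_g(\epsilon)-1}$ be the total number of evaluations of $F$ executed by TRFD up to (and including) iteration $T_g(\epsilon)-1$. Then $$FE_{T_g(\epsilon)-1}\le (n+1)\Bigg[\frac{16L_{h,p}\max\{\sigma,L_J\}c_{p,2}(m)c_{2,p}(n)^2(f(x_0)-f_{low})}{\alpha(1-\alpha)\theta^2}\epsilon^{-2}+\left\lceil\left|\log_2\left(\frac{4\max\{\sigma,L_J\}c_{2,p}(n)}{\sigma(1-\alpha)\theta}\right)\right|\right\rceil+\log_2\left(\frac{4L_{h,p}\max\{\sigma,L_J\}c_{p,2}(m)c_{2,p}(n)^2\Delta_0}{(1-\alpha)\theta}\epsilon^{-1}\right)+1\Bigg].$$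
   Context: Notation: $n,m\ge1$ integers, $p\in\{1,2,3,\ldots\}\cup\{\infty\}$, $\|\cdot\|_p$ the $p$-norm (for matrices $\|\cdot\|_2$ is the spectral norm), $J_F$ the Jacobian of $F$, $f=h\circ F$, $\Omega-\{x\}=\{s\in\mathbb{R}^n:x+s\in\Omega\}$, $[A]_j$ the $j$-th column of $A$, $e_j$ the $j$-th canonical vector. $c_{2,p}(n),c_{p,2}(m)\ge1$ are fixed constants with $\|x\|_2\le c_{2,p}(n)\|x\|_p$ for all $x\in\mathbb{R}^n$ and $\|z\|_p\le c_{p,2}(m)\|z\|_2$ for all $z\in\mathbb{R}^m$. $L_{h,p},L_J>0$. For $r>0$, $x\in\Omega$, $A\in\mathbb{R}^{m\times n}$, $$\psi_{p,r}(x)=\tfrac1r\Big(h(F(x))-\min_{s\in\Omega-\{x\},\,\|s\|_p\le r}h(F(x)+J_F(x)s)\Big),\qquad \eta_{p,r}(x;A)=\tfrac1r\Big(h(F(x))-\min_{s\in\Omega-\{x\},\,\|s\|_p\le r}h(F(x)+As)\Big).$$ Algorithm TRFD. Step 0: given $x_0\in\Omega$, $\epsilon>0$, $\sigma>0$, $\alpha\in(0,1)$, $\theta\in(0,1]$ and $L_{h,p}$, set $\tau_0=\epsilon/(L_{h,p}\sigma c_{p,2}(m)c_{2,p}(n)\sqrt n)$, choose $\Delta_0,\Delta_*$ with $\tau_0\sqrt n\le\Delta_0\le\Delta_*$, set $k:=0$. Step 1: construct $A_k\in\mathbb{R}^{m\times n}$ with $[A_k]_j=(F(x_k+\tau_ke_j)-F(x_k))/\tau_k$,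 $j=1,\ldots,n$, and compute $\eta_{p,\Delta_*}(x_k;A_k)$. Step 2: if $\eta_{p,\Delta_*}(x_k;A_k)\ge\epsilon/2$ go to Step 3; otherwise set $x_{k+1}=x_k$, $\Delta_{k+1}=\Delta_k$, $\tau_{k+1}=\frac12\tau_k$, $k:=k+1$ and go to Step 1. Step 3: let $d_k^*$ minimize $h(F(x_k)+A_kd)$ subject to $\|d\|_p\le\Delta_k$, $x_k+d\in\Omega$; compute any $d_k$ with $\|d_k\|_p\le\Delta_k$, $x_k+d_k\in\Omega$ and $h(F(x_k))-h(F(x_k)+A_kd_k)\ge\theta[h(F(x_k))-h(F(x_k)+A_kd_k^* )]$. Step 4: compute $\rho_k=\frac{h(F(x_k))-h(F(x_k+d_k))}{h(F(x_k))-h(F(x_k)+A_kd_k)}$; if $\rho_k\ge\alpha$, set $x_{k+1}=x_k+d_k$, $\Delta_{k+1}=\min\{2\Delta_k,\Delta_*\}$, $\tau_{k+1}=\tau_k$, $k:=k+1$ and go to Step 1. Step 5: (if $\rho_k<\alpha$) set $x_{k+1}=x_k$, $\Delta_{k+1}=\frac12\Delta_k$; if $\tau_k\sqrt n\le\Delta_{k+1}$, set $\tau_{k+1}=\tau_k$, $A_{k+1}=A_k$, $k:=k+1$ and go to Step 3; otherwise set $\tau_{k+1}=\frac12\tau_k$, $k:=k+1$ and go to Step 1. (No stopping test: the algorithm generates infinite sequences.) Counting of evaluations: $F(x_0)$ is evaluated once at the start; constructing $A_k$ at Step 1 costs the $n$ evaluations $F(x_k+\tau_ke_j)$; Step 4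 costs the single evaluation $F(x_k+d_k)$; already computed values $F(x_k)$ are stored and reused, and no evaluation is needed when $A_{k+1}=A_k$ is reused. Convention: $\inf\emptyset=+\infty$ (the claim includes that $T_g(\epsilon)$ is finite); if $T_g(\epsilon)=0$ then no iteration is counted. *)

theory Defs
  imports "HOL-Analysis.Analysis" "HOL-Library.Extended_Nat"
begin

definition pnorm :: "enat \<Rightarrow> real ^ 'n \<Rightarrow> real" where
  "pnorm p x = (case p of enat k \<Rightarrow> root k (\<Sum>i\<in>UNIV. \<bar>x $ i\<bar> ^ k) | \<infinity> \<Rightarrow> infnorm x)"

definition spectral_norm :: "real ^ 'n ^ 'm \<Rightarrow> real" where
  "spectral_norm M = onorm (\<lambda>v. M *v v)"

text \<open>
  The minimum of the model is written literally as the least element of the set of model values.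
  It exists for nonempty closed \<open>\<Omega>\<close>, \<open>x \<in> \<Omega>\<close>, \<open>r > 0\<close> and continuous \<open>h\<close>.
\<close>

definition eta ::
  "enat \<Rightarrow> (real ^ 'n) set \<Rightarrow> (real ^ 'm \<Rightarrow> real) \<Rightarrow> (real ^ 'n \<Rightarrow> real ^ 'm) \<Rightarrow> real
   \<Rightarrow> real ^ 'n \<Rightarrow> real ^ 'n ^ 'm \<Rightarrow> real" where
  "eta p \<Omega> h F r x A =
     (1 / r) * (h (F x) -
       (LEAST v. v \<in> (\<lambda>s. h (F x + A *v s)) ` {s. x + s \<in> \<Omega> \<and> pnorm p s \<le> r}))"

definition psi ::
  "enat \<Rightarrow> (real ^ 'n) set \<Rightarrow> (real ^ 'm \<Rightarrow> real) \<Rightarrow> (real ^ 'n \<Rightarrow> real ^ 'm) \<Rightarrow> real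
   \<Rightarrow> real ^ 'n \<Rightarrow> real" where
  "psi p \<Omega> h F r x =
     (1 / r) * (h (F x) -
       (LEAST v. v \<in> (\<lambda>s. h (F x + jacobian F (at x) *v s)) ` {s. x + s \<in> \<Omega> \<and> pnorm p s \<le> r}))"

text \<open>
  A run of TRFD is given by the sequences \<open>x\<close>, \<open>\<Delta>\<close>, \<open>\<tau>\<close>, \<open>A\<close>, \<open>d\<close> together with \<open>entry\<close>, where
  \<open>entry k\<close> is the step of the algorithm at which iteration \<open>k\<close> begins: \<open>Step1\<close> (a new matrix
  \<open>A k\<close> is constructed) or \<open>Step3\<close> (the matrix of the previous iteration is reused).
  If iteration \<open>k\<close> ends at Step 2, then \<open>d k\<close> is not constrained.
\<close>

datatype entry_step = Step1 | Step3

definition reaches_step3 ::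
  "enat \<Rightarrow> (real ^ 'n) set \<Rightarrow> (real ^ 'm \<Rightarrow> real) \<Rightarrow> (real ^ 'n \<Rightarrow> real ^ 'm) \<Rightarrow> real \<Rightarrow> real
   \<Rightarrow> (nat \<Rightarrow> real ^ 'n) \<Rightarrow> (nat \<Rightarrow> real ^ 'n ^ 'm) \<Rightarrow> (nat \<Rightarrow> entry_step) \<Rightarrow> nat \<Rightarrow> bool" where
  "reaches_step3 p \<Omega> h F \<epsilon> \<Delta>s x A entry k \<longleftrightarrow>
     entry k = Step3 \<or> eta p \<Omega> h F \<Delta>s (x k) (A k) \<ge> \<epsilon> / 2"

definition trfd_init ::
  "(real ^ 'n) set \<Rightarrow> real \<Rightarrow> real \<Rightarrow> real \<Rightarrow> real \<Rightarrow> real \<Rightarrow> real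
   \<Rightarrow> (nat \<Rightarrow> real ^ 'n) \<Rightarrow> (nat \<Rightarrow> real) \<Rightarrow> (nat \<Rightarrow> real) \<Rightarrow> (nat \<Rightarrow> entry_step) \<Rightarrow> bool" where
  "trfd_init \<Omega> L cp2 c2p \<epsilon> \<sigma> \<Delta>s x \<Delta> \<tau> entry \<longleftrightarrow>
     x 0 \<in> \<Omega> \<and>
     \<tau> 0 = \<epsilon> / (L * \<sigma> * cp2 * c2p * sqrt (real CARD('n))) \<and>
     \<tau> 0 * sqrt (real CARD('n)) \<le> \<Delta> 0 \<and> \<Delta> 0 \<le> \<Delta>s \<and>
     entry 0 = Step1"

definition trfd_iteration ::
  "enat \<Rightarrow> (real ^ 'n) set \<Rightarrow> (real ^ 'm \<Rightarrow> real) \<Rightarrow> (real ^ 'n \<Rightarrow> real ^ 'm)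
   \<Rightarrow> real \<Rightarrow> real \<Rightarrow> real \<Rightarrow> real
   \<Rightarrow> (nat \<Rightarrow> real ^ 'n) \<Rightarrow> (nat \<Rightarrow> real) \<Rightarrow> (nat \<Rightarrow> real) \<Rightarrow> (nat \<Rightarrow> real ^ 'n ^ 'm)
   \<Rightarrow> (nat \<Rightarrow> real ^ 'n) \<Rightarrow> (nat \<Rightarrow> entry_step) \<Rightarrow> nat \<Rightarrow> bool" where
  "trfd_iteration p \<Omega> h F \<epsilon> \<alpha> \<theta> \<Delta>s x \<Delta> \<tau> A d entry k \<longleftrightarrow>
     (entry k = Step1 \<longrightarrow>
        (\<forall>j. column j (A k) = (F (x k + \<tau> k *\<^sub>R axis j 1) - F (x k)) /\<^sub>R \<tau> k)) \<and>
     (if reaches_step3 p \<Omega> h F \<epsilon> \<Delta>s x A entry k then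
        pnorm p (d k) \<le> \<Delta> k \<and> x k + d k \<in> \<Omega> \<and>
        (\<exists>ds. is_arg_min (\<lambda>u. h (F (x k) + A k *v u))
                (\<lambda>u. pnorm p u \<le> \<Delta> k \<and> x k + u \<in> \<Omega>) ds \<and>
              h (F (x k)) - h (F (x k) + A k *v d k)
                \<ge> \<theta> * (h (F (x k)) - h (F (x k) + A k *v ds))) \<and>
        (if (h (F (x k)) - h (F (x k + d k))) / (h (F (x k)) - h (F (x k) + A k *v d k)) \<ge> \<alpha> then
           x (Suc k) = x k + d k \<and> \<Delta> (Suc k) = min (2 * \<Delta> k) \<Delta>s \<and> \<tau> (Suc k) = \<tau> k \<and>
           entry (Suc k) = Step1
         else
           x (Suc k) = x k \<and> \<Delta> (Suc k) = \<Delta> k / 2 \<and>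
           (if \<tau> k * sqrt (real CARD('n)) \<le> \<Delta> (Suc k) then
              \<tau> (Suc k) = \<tau> k \<and> A (Suc k) = A k \<and> entry (Suc k) = Step3
            else
              \<tau> (Suc k) = \<tau> k / 2 \<and> entry (Suc k) = Step1))
      else
        x (Suc k) = x k \<and> \<Delta> (Suc k) = \<Delta> k \<and> \<tau> (Suc k) = \<tau> k / 2 \<and> entry (Suc k) = Step1)"

definition trfd ::
  "enat \<Rightarrow> (real ^ 'n) set \<Rightarrow> (real ^ 'm \<Rightarrow> real) \<Rightarrow> (real ^ 'n \<Rightarrow> real ^ 'm)
   \<Rightarrow> real \<Rightarrow> real \<Rightarrow> real \<Rightarrow> real \<Rightarrow> real \<Rightarrow> real \<Rightarrow> real \<Rightarrow> real
   \<Rightarrow> (nat \<Rightarrow> real ^ 'n) \<Rightarrow> (nat \<Rightarrow> real) \<Rightarrow> (nat \<Rightarrow> real) \<Rightarrow> (nat \<Rightarrow> real ^ 'n ^ 'm)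
   \<Rightarrow> (nat \<Rightarrow> real ^ 'n) \<Rightarrow> (nat \<Rightarrow> entry_step) \<Rightarrow> bool" where
  "trfd p \<Omega> h F L cp2 c2p \<epsilon> \<sigma> \<alpha> \<theta> \<Delta>s x \<Delta> \<tau> A d entry \<longleftrightarrow>
     trfd_init \<Omega> L cp2 c2p \<epsilon> \<sigma> \<Delta>s x \<Delta> \<tau> entry \<and>
     (\<forall>k. trfd_iteration p \<Omega> h F \<epsilon> \<alpha> \<theta> \<Delta>s x \<Delta> \<tau> A d entry k)"

text \<open>
  The number of evaluations of \<open>F\<close> executed before iteration \<open>N\<close>, i.e. up to and including
  iteration \<open>N - 1\<close>: one for the starting point, \<open>n\<close> for every matrix constructed at Step 1,
  and one for every trial point tested at Step 4.  The values \<open>F (x k)\<close> are stored.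
\<close>

definition F_evals ::
  "enat \<Rightarrow> (real ^ 'n) set \<Rightarrow> (real ^ 'm \<Rightarrow> real) \<Rightarrow> (real ^ 'n \<Rightarrow> real ^ 'm) \<Rightarrow> real \<Rightarrow> real
   \<Rightarrow> (nat \<Rightarrow> real ^ 'n) \<Rightarrow> (nat \<Rightarrow> real ^ 'n ^ 'm) \<Rightarrow> (nat \<Rightarrow> entry_step) \<Rightarrow> nat \<Rightarrow> nat" where
  "F_evals p \<Omega> h F \<epsilon> \<Delta>s x A entry N =
     1 + (\<Sum>k<N. (if entry k = Step1 then CARD('n) else 0) +
                 (if reaches_step3 p \<Omega> h F \<epsilon> \<Delta>s x A entry k then 1 else 0))"

definition T_g ::
  "enat \<Rightarrow> (real ^ 'n) set \<Rightarrow> (real ^ 'm \<Rightarrow> real) \<Rightarrow> (real ^ 'n \<Rightarrow> real ^ 'm) \<Rightarrow> real \<Rightarrow> real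
   \<Rightarrow> (nat \<Rightarrow> real ^ 'n) \<Rightarrow> enat" where
  "T_g p \<Omega> h F \<epsilon> \<Delta>s x = Inf {enat k | k. psi p \<Omega> h F \<Delta>s (x k) \<le> \<epsilon>}"

end

theory Submission
  imports Defs
begin

text \<open>
  Write \<open>M = max \<sigma> L\<^sub>J\<close>. The finite-difference matrix at \<open>x k\<close> is within
  \<open>L\<^sub>J \<surd>n \<tau> k / 2\<close> of the Jacobian. As \<open>\<tau> k \<surd>n \<le> \<Delta> k\<close> throughout, a trial step of
  length at most \<open>\<Delta> k\<close> changes \<open>f\<close> and its model by amounts that differ by \<open>O((\<Delta> k)\<^sup>2)\<close>, whereas
  the model decrease is at least \<open>\<theta> \<epsilon> \<Delta> k / 2\<close>. Hence steps with small radius are accepted, and the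
  radius never falls below \<open>radius_min = (1 - \<alpha>) \<theta> \<epsilon> / (4 L M cp2 c2p\<^sup>2)\<close>. While \<open>psi > \<epsilon>\<close>, the
  parameter \<open>\<tau>\<close> is halved only if \<open>\<tau> k \<surd>n \<ge> radius_min\<close>: at Step 2 because otherwise \<open>eta\<close> would
  be close to \<open>psi\<close>, at Step 5 because \<open>\<tau> k \<surd>n\<close> exceeds the new radius.

  Three quantities then bound the number of iterations: every successful step lowers \<open>f\<close> by a fixed
  multiple of \<open>\<epsilon>\<^sup>2\<close>; every rejected step halves the radius, which only successful steps can
  increase, at most doubling it; and \<open>\<tau>\<close> can be halved only logarithmically often. A matrix is
  constructed only at the start and after successful and halving iterations.
\<close>

section \<open>Elementary facts on the \<open>p\<close>-norm and the spectral norm\<close>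

lemma pnorm_scaleR:
  fixes x :: "real ^ 'n"
  assumes "p \<ge> 1"
  shows "pnorm p (c *\<^sub>R x) = \<bar>c\<bar> * pnorm p x"
proof (cases p)
  case (enat k)
  with assms have k: "0 < k"
    by (simp add: one_enat_def)
  have "(\<Sum>i\<in>UNIV. \<bar>(c *\<^sub>R x) $ i\<bar> ^ k) = \<bar>c\<bar> ^ k * (\<Sum>i\<in>UNIV. \<bar>x $ i\<bar> ^ k)"
    by (simp add: abs_mult power_mult_distrib sum_distrib_left)
  with enat k show ?thesis
    by (simp add: pnorm_def real_root_mult real_root_power_cancel)
qed (simp add: pnorm_def infnorm_mul)

lemma pnorm_zero: "p \<ge> 1 \<Longrightarrow> pnorm p (0 :: real ^ 'n) = 0"
  using pnorm_scaleR[of p 0 "0 :: real ^ 'n"] by simp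

lemma continuous_on_pnorm: "continuous_on S (pnorm p)"
  by (cases p) (auto simp: pnorm_def[abs_def] intro!: continuous_intros)

lemma norm_matrix_vector_le_spectral_norm: "norm (M *v v) \<le> spectral_norm M * norm v"
  unfolding spectral_norm_def by (intro onorm) simp

section \<open>Taylor remainder and forward differences\<close>

text \<open>Mean value inequality on [0, 1] for \<open>F\<close> along the segment minus its linear
  part: the derivative has norm at most \<open>K * (norm s)\<^sup>2 * t\<close>, whose primitive
  serves as the majorant.\<close>

lemma jacobian_quadratic_remainder:
  fixes F :: "real ^ 'n \<Rightarrow> real ^ 'm"
  assumes diff: "\<And>u. F differentiable (at u)"
    and lip: "\<And>u v. spectral_norm (jacobian F (at u) - jacobian F (at v)) \<le> K * norm (u - v)"
  shows "norm (F (u + s) - F u - jacobian F (at u) *v s) \<le> K / 2 * (norm s)\<^sup>2"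
proof -
  let ?J = "\<lambda>u. jacobian F (at u)"
  let ?g = "\<lambda>t. F (u + t *\<^sub>R s) - t *\<^sub>R (?J u *v s)"
  have F': "(F has_derivative (\<lambda>v. ?J w *v v)) (at w)" for w
    using diff jacobian_works by blast
  have deriv: "(?g has_vector_derivative (?J (u + t *\<^sub>R s) *v s - ?J u *v s)) (at t)" for t
  proof -
    have "((\<lambda>t. F (u + t *\<^sub>R s)) has_derivative (\<lambda>r. ?J (u + t *\<^sub>R s) *v (r *\<^sub>R s))) (at t)"
      by (rule has_derivative_compose[OF _ F']) (auto intro!: derivative_eq_intros)
    then have "((\<lambda>t. F (u + t *\<^sub>R s)) has_vector_derivative ?J (u + t *\<^sub>R s) *v s) (at t)"
      by (simp add: has_vector_derivative_def scaleR_matrix_vector_assoc matrix_vector_mult_scaleR)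
    then show ?thesis
      by (auto intro!: derivative_eq_intros)
  qed
  have "norm (?g 1 - ?g 0) \<le> K / 2 * (norm s)\<^sup>2 * 1\<^sup>2 - K / 2 * (norm s)\<^sup>2 * 0\<^sup>2"
  proof (rule differentiable_bound_general[where f = ?g
        and f' = "\<lambda>t. ?J (u + t *\<^sub>R s) *v s - ?J u *v s"
        and \<phi> = "\<lambda>t. K / 2 * (norm s)\<^sup>2 * t\<^sup>2" and \<phi>' = "\<lambda>t. K * (norm s)\<^sup>2 * t"])
    show "continuous_on {0..1} ?g"
      using deriv by (meson continuous_at_imp_continuous_on has_vector_derivative_continuous)
  next
    fix t :: real assume t: "0 < t" "t < 1"
    show "(?g has_vector_derivative (?J (u + t *\<^sub>R s) *v s - ?J u *v s)) (at t)"
      by (rule deriv)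
    show "((\<lambda>t. K / 2 * (norm s)\<^sup>2 * t\<^sup>2) has_vector_derivative K * (norm s)\<^sup>2 * t) (at t)"
      by (auto intro!: derivative_eq_intros simp flip: has_real_derivative_iff_has_vector_derivative)
    have "norm (?J (u + t *\<^sub>R s) *v s - ?J u *v s)
        \<le> spectral_norm (?J (u + t *\<^sub>R s) - ?J u) * norm s"
      by (metis matrix_vector_mult_diff_rdistrib norm_matrix_vector_le_spectral_norm)
    also have "\<dots> \<le> K * norm (u + t *\<^sub>R s - u) * norm s"
      by (intro mult_right_mono lip) auto
    also have "\<dots> = K * (norm s)\<^sup>2 * t"
      using t by (simp add: power2_eq_square)
    finally show "norm (?J (u + t *\<^sub>R s) *v s - ?J u *v s) \<le> K * (norm s)\<^sup>2 * t" .
  qed (auto intro!: continuous_intros)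
  then show ?thesis
    by (simp add: algebra_simps)
qed

lemma sum_abs_le_sqrt_card_mult_norm:
  fixes v :: "real ^ 'n"
  shows "(\<Sum>j\<in>UNIV. \<bar>v $ j\<bar>) \<le> sqrt (real CARD('n)) * norm v"
  using L2_set_mult_ineq[of "\<lambda>j. v $ j" "\<lambda>_. 1" UNIV]
  by (simp add: norm_vec_def L2_set_def mult.commute)

text \<open>Triangle inequality over the columns; Cauchy-Schwarz on the coefficients produces the
  square root of the dimension.\<close>

lemma norm_matrix_vector_le_columns:
  fixes M :: "real ^ 'n ^ 'm"
  assumes "\<And>j. norm (column j M) \<le> b"
  shows "norm (M *v v) \<le> b * sqrt (real CARD('n)) * norm v"
proof -
  have b: "0 \<le> b"
    using assms norm_ge_zero order_trans by blast
  have "norm (M *v v) \<le> (\<Sum>j\<in>UNIV. \<bar>v $ j\<bar> * norm (column j M))"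
    unfolding matrix_mult_sum by (rule sum_norm_le) (simp add: scalar_mult_eq_scaleR)
  also have "\<dots> \<le> (\<Sum>j\<in>UNIV. \<bar>v $ j\<bar>) * b"
    unfolding sum_distrib_right by (intro sum_mono mult_left_mono assms) auto
  also have "\<dots> \<le> sqrt (real CARD('n)) * norm v * b"
    by (intro mult_right_mono sum_abs_le_sqrt_card_mult_norm b)
  finally show ?thesis
    by (simp add: mult_ac)
qed

text \<open>Each column of the error is the Taylor remainder along a coordinate step of length
  \<open>t\<close>, divided by \<open>t\<close>.\<close>

lemma forward_difference_jacobian_error:
  fixes F :: "real ^ 'n \<Rightarrow> real ^ 'm"
  assumes diff: "\<And>u. F differentiable (at u)"
    and lip: "\<And>u v. spectral_norm (jacobian F (at u) - jacobian F (at v)) \<le> K * norm (u - v)"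
    and t: "0 < t"
    and B: "\<And>j. column j B = (F (u + t *\<^sub>R axis j 1) - F u) /\<^sub>R t"
  shows "norm ((B - jacobian F (at u)) *v v) \<le> K * sqrt (real CARD('n)) / 2 * t * norm v"
proof -
  let ?J = "jacobian F (at u)"
  have "norm (column j (B - ?J)) \<le> K / 2 * t" for j
  proof -
    have "column j (B - ?J) = column j B - ?J *v axis j 1"
      by (simp add: matrix_vector_mult_basis column_def vec_eq_iff)
    also have "\<dots> = (F (u + t *\<^sub>R axis j 1) - F u - ?J *v (t *\<^sub>R axis j 1)) /\<^sub>R t"
      using t by (simp add: B matrix_vector_mult_scaleR scaleR_diff_right)
    finally have "norm (column j (B - ?J))
        = norm (F (u + t *\<^sub>R axis j 1) - F u - ?J *v (t *\<^sub>R axis j 1)) / t"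
      using t by (simp add: divide_inverse_commute)
    also have "\<dots> \<le> K / 2 * (norm (t *\<^sub>R axis j 1 :: real ^ 'n))\<^sup>2 / t"
      using t by (intro divide_right_mono jacobian_quadratic_remainder diff lip) auto
    also have "\<dots> = K / 2 * t"
      using t by (simp add: power2_eq_square)
    finally show ?thesis .
  qed
  from norm_matrix_vector_le_columns[OF this] show ?thesis
    by (simp add: mult_ac)
qed

section \<open>Setting and classification of iterations\<close>

locale trfd_run =
  fixes \<Omega> :: "(real ^ 'n) set"
    and F :: "real ^ 'n \<Rightarrow> real ^ 'm"
    and h :: "real ^ 'm \<Rightarrow> real"
    and p :: enat
    and L L\<^sub>J c2p cp2 f_low \<epsilon> \<sigma> \<alpha> \<theta> \<Delta>s :: real
    and x d :: "nat \<Rightarrow> real ^ 'n"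
    and \<Delta> \<tau> :: "nat \<Rightarrow> real"
    and A :: "nat \<Rightarrow> real ^ 'n ^ 'm"
    and entry :: "nat \<Rightarrow> entry_step"
  assumes p_ge: "p \<ge> 1"
    and c2p_ge: "c2p \<ge> 1" and norm_le_pnorm: "\<And>u :: real ^ 'n. norm u \<le> c2p * pnorm p u"
    and cp2_ge: "cp2 \<ge> 1" and pnorm_le_norm: "\<And>z :: real ^ 'm. pnorm p z \<le> cp2 * norm z"
    and L_pos: "L > 0" and LJ_pos: "L\<^sub>J > 0"
    and closed_\<Omega>: "closed \<Omega>" and convex_\<Omega>: "convex \<Omega>"
    and F_diff: "\<And>u. F differentiable (at u)"
    and J_lipschitz:
      "\<And>u v. spectral_norm (jacobian F (at u) - jacobian F (at v)) \<le> L\<^sub>J * norm (u - v)"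
    and convex_h: "convex_on UNIV h"
    and h_lipschitz: "\<And>z w. \<bar>h z - h w\<bar> \<le> L * pnorm p (z - w)"
    and f_ge: "\<And>u. h (F u) \<ge> f_low"
    and eps_pos: "\<epsilon> > 0" and sigma_pos: "\<sigma> > 0" and alpha_pos: "0 < \<alpha>" and alpha_less: "\<alpha> < 1"
    and theta_pos: "0 < \<theta>" and theta_le: "\<theta> \<le> 1"
    and run: "trfd p \<Omega> h F L cp2 c2p \<epsilon> \<sigma> \<alpha> \<theta> \<Delta>s x \<Delta> \<tau> A d entry"
begin

abbreviation J :: "real ^ 'n \<Rightarrow> real ^ 'n ^ 'm" where
  "J u \<equiv> jacobian F (at u)"

abbreviation lip_max :: real where
  "lip_max \<equiv> max \<sigma> L\<^sub>J"

abbreviation model_step :: "nat \<Rightarrow> bool" where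
  "model_step \<equiv> reaches_step3 p \<Omega> h F \<epsilon> \<Delta>s x A entry"

definition model_decrease :: "nat \<Rightarrow> real" where
  "model_decrease k = h (F (x k)) - h (F (x k) + A k *v d k)"

definition actual_decrease :: "nat \<Rightarrow> real" where
  "actual_decrease k = h (F (x k)) - h (F (x k + d k))"

definition successful :: "nat \<Rightarrow> bool" where
  "successful k \<longleftrightarrow> model_step k \<and> actual_decrease k / model_decrease k \<ge> \<alpha>"

definition rejected :: "nat \<Rightarrow> bool" where
  "rejected k \<longleftrightarrow> model_step k \<and> \<not> actual_decrease k / model_decrease k \<ge> \<alpha>"

text \<open>Covers both exits that halve \<open>\<tau>\<close>: a failed test at Step 2, and the
  return from Step 5 to Step 1. In the second case the iteration is also
  \<open>rejected\<close>.\<close>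

definition halving :: "nat \<Rightarrow> bool" where
  "halving k \<longleftrightarrow> \<not> model_step k \<or> rejected k \<and> \<not> \<tau> k * sqrt (real CARD('n)) \<le> \<Delta> (Suc k)"

text \<open>Half the radius at which the model error reaches (1 - \<alpha>) times the guaranteed
  model decrease; the factor one half leaves room for one last rejection.\<close>

definition radius_min :: real where
  "radius_min = (1 - \<alpha>) * \<theta> * \<epsilon> / (4 * L * lip_max * cp2 * c2p\<^sup>2)"

lemma lip_max_pos: "0 < lip_max"
  using sigma_pos by simp

lemma radius_min_pos: "0 < radius_min"
  using alpha_less theta_pos eps_pos L_pos lip_max_pos cp2_ge c2p_ge
  by (simp add: radius_min_def)

text \<open>Drops the factor \<open>(1 - \<alpha>) * \<theta> / c2p\<close>, which is at most 1, to
  allow comparison with the failed test at Step 2.\<close>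

lemma radius_min_le: "radius_min \<le> \<epsilon> / (4 * L * lip_max * cp2 * c2p)"
proof -
  have "(1 - \<alpha>) * \<theta> \<le> 1 * c2p"
    using alpha_pos alpha_less theta_pos theta_le c2p_ge by (intro mult_mono) auto
  then have "(1 - \<alpha>) * \<theta> / c2p \<le> 1"
    using c2p_ge by simp
  then have "(1 - \<alpha>) * \<theta> / c2p * (\<epsilon> / (4 * L * lip_max * cp2 * c2p))
      \<le> 1 * (\<epsilon> / (4 * L * lip_max * cp2 * c2p))"
    using eps_pos L_pos lip_max_pos cp2_ge c2p_ge by (intro mult_right_mono) auto
  then show ?thesis
    by (simp add: radius_min_def power2_eq_square mult_ac)
qed

section \<open>Model minimizers, stationarity measures and model error\<close>

lemma h_lipschitz_norm: "\<bar>h z - h w\<bar> \<le> L * cp2 * norm (z - w)"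
proof -
  have "\<bar>h z - h w\<bar> \<le> L * pnorm p (z - w)"
    by (rule h_lipschitz)
  also have "\<dots> \<le> L * (cp2 * norm (z - w))"
    using L_pos by (intro mult_left_mono pnorm_le_norm) auto
  finally show ?thesis
    by (simp add: mult_ac)
qed

lemma continuous_on_h: "continuous_on UNIV h"
proof (rule lipschitz_on_continuous_on)
  show "(L * cp2)-lipschitz_on UNIV h"
    using h_lipschitz_norm L_pos cp2_ge
    by (auto intro!: lipschitz_onI simp: dist_norm)
qed

lemma compact_feasible_steps: "compact {s. u + s \<in> \<Omega> \<and> pnorm p s \<le> r}"
proof -
  have "closed ({s. u + s \<in> \<Omega>} \<inter> {s. pnorm p s \<le> r})"
  proof (intro closed_Int)
    show "closed {s. u + s \<in> \<Omega>}"
    proof -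
      have "continuous_on UNIV (\<lambda>s. u + s)"
        by (intro continuous_intros)
      from closed_vimage[OF closed_\<Omega> this] show ?thesis
        by (simp add: vimage_def)
    qed
    show "closed {s :: real ^ 'n. pnorm p s \<le> r}"
      by (intro closed_Collect_le continuous_on_pnorm continuous_intros)
  qed
  moreover have "norm s \<le> c2p * r" if "pnorm p s \<le> r" for s :: "real ^ 'n"
    using norm_le_pnorm[of s] mult_left_mono[OF that, of c2p] c2p_ge by linarith
  then have "bounded ({s. u + s \<in> \<Omega>} \<inter> {s. pnorm p s \<le> r})"
    unfolding bounded_iff by blast
  ultimately show ?thesis
    by (simp add: compact_eq_bounded_closed Int_def)
qed

text \<open>By compactness and continuity the \<open>LEAST\<close> in \<open>eta\<close> is a true
  minimum; from here on only the minimizer is used.\<close>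

lemma eta_attained:
  assumes "u \<in> \<Omega>" "0 \<le> r"
  obtains s where "u + s \<in> \<Omega>" "pnorm p s \<le> r"
    "eta p \<Omega> h F r u B = (h (F u) - h (F u + B *v s)) / r"
    "\<And>s'. u + s' \<in> \<Omega> \<Longrightarrow> pnorm p s' \<le> r \<Longrightarrow> h (F u + B *v s) \<le> h (F u + B *v s')"
proof -
  let ?S = "{s. u + s \<in> \<Omega> \<and> pnorm p s \<le> r}"
  have "0 \<in> ?S"
    using assms p_ge by (simp add: pnorm_zero)
  moreover have "continuous_on ?S (\<lambda>s. h (F u + B *v s))"
    by (intro continuous_on_compose2[OF continuous_on_h] continuous_intros
        linear_continuous_on matrix_vector_mul_bounded_linear) auto
  ultimately obtain s where s: "s \<in> ?S" "\<forall>s'\<in>?S. h (F u + B *v s) \<le> h (F u + B *v s')"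
    using continuous_attains_inf[OF compact_feasible_steps, of u r] by blast
  then have "(LEAST v. v \<in> (\<lambda>s. h (F u + B *v s)) ` ?S) = h (F u + B *v s)"
    by (intro Least_equality) auto
  then have "eta p \<Omega> h F r u B = (h (F u) - h (F u + B *v s)) / r"
    by (simp add: eta_def)
  then show ?thesis
    by (rule that[rotated 2]) (use s in auto)
qed

lemma psi_eq_eta: "psi p \<Omega> h F r u = eta p \<Omega> h F r u (J u)"
  by (simp add: psi_def eta_def)

text \<open>The minimizer for the exact Jacobian competes in the model with \<open>B\<close>.
  Changing the matrix costs at most \<open>L * cp2 * e * (c2p * r)\<close>, and division by
  \<open>r\<close> removes the radius.\<close>

lemma psi_le_eta:
  assumes u: "u \<in> \<Omega>" and r: "0 < r"
    and err: "\<And>v. norm ((B - J u) *v v) \<le> e * norm v"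
  shows "psi p \<Omega> h F r u \<le> eta p \<Omega> h F r u B + L * cp2 * c2p * e"
proof -
  obtain s where s: "u + s \<in> \<Omega>" "pnorm p s \<le> r"
    "eta p \<Omega> h F r u (J u) = (h (F u) - h (F u + J u *v s)) / r"
    using eta_attained[of u r "J u"] u r by (metis less_imp_le)
  obtain s' where s': "eta p \<Omega> h F r u B = (h (F u) - h (F u + B *v s')) / r"
    "\<And>s. u + s \<in> \<Omega> \<Longrightarrow> pnorm p s \<le> r \<Longrightarrow> h (F u + B *v s') \<le> h (F u + B *v s)"
    using eta_attained[of u r B] u r by (metis less_imp_le)
  \<comment> \<open>Any unit vector in \<open>err\<close> shows this.\<close>
  have e: "0 \<le> e"
    using order_trans[OF norm_ge_zero err[of "axis undefined 1"]] by simp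
  have "h (F u + B *v s') \<le> h (F u + B *v s)"
    using s s' by blast
  also have "\<dots> \<le> h (F u + J u *v s) + L * cp2 * norm ((B - J u) *v s)"
    using h_lipschitz_norm[of "F u + B *v s" "F u + J u *v s"]
    by (simp add: matrix_vector_mult_diff_rdistrib abs_le_iff)
  also have "norm ((B - J u) *v s) \<le> e * (c2p * r)"
  proof -
    have "norm s \<le> c2p * r"
      using norm_le_pnorm[of s] s(2) c2p_ge
      by (meson mult_left_mono order_trans zero_le_one)
    then show ?thesis
      using err[of s] mult_left_mono[OF _ e] by (meson order_trans)
  qed
  finally have "h (F u + B *v s') \<le> h (F u + J u *v s) + L * cp2 * (e * (c2p * r))"
    using L_pos cp2_ge by simp
  then have "(h (F u) - h (F u + J u *v s)) / r
      \<le> ((h (F u) - h (F u + B *v s')) + L * cp2 * (e * (c2p * r))) / r"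
    using r by (intro divide_right_mono) auto
  also have "\<dots> = (h (F u) - h (F u + B *v s')) / r + L * cp2 * c2p * e"
    using r by (simp add: field_simps)
  finally show ?thesis
    using s(3) s'(1) psi_eq_eta by simp
qed

text \<open>By convexity of \<open>h\<close> the best model decrease per unit of radius does not increase with the
  radius; the witness is the minimizer for the radius \<open>r'\<close>, scaled by \<open>r / r'\<close>.\<close>

lemma model_decrease_scaled:
  assumes u: "u \<in> \<Omega>" and r: "0 < r" "r \<le> r'"
  obtains s where "u + s \<in> \<Omega>" "pnorm p s \<le> r"
    "r * eta p \<Omega> h F r' u B \<le> h (F u) - h (F u + B *v s)"
proof -
  obtain s where s: "u + s \<in> \<Omega>" "pnorm p s \<le> r'"
    "eta p \<Omega> h F r' u B = (h (F u) - h (F u + B *v s)) / r'"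
    using eta_attained[of u r' B] u r by (metis less_imp_le order_trans)
  define c where "c = r / r'"
  have c: "0 < c" "c \<le> 1" "c * r' = r"
    using r by (auto simp: c_def)
  have "(1 - c) *\<^sub>R u + c *\<^sub>R (u + s) \<in> \<Omega>"
    using convex_\<Omega> u s(1) c by (intro convexD) auto
  then have "u + c *\<^sub>R s \<in> \<Omega>"
    by (simp add: algebra_simps)
  moreover have "pnorm p (c *\<^sub>R s) \<le> r"
    using c s(2) p_ge by (metis abs_of_pos mult_left_mono less_imp_le pnorm_scaleR)
  moreover have "r * eta p \<Omega> h F r' u B \<le> h (F u) - h (F u + B *v (c *\<^sub>R s))"
  proof -
    have "F u + B *v (c *\<^sub>R s) = (1 - c) *\<^sub>R F u + c *\<^sub>R (F u + B *v s)"
      by (simp add: matrix_vector_mult_scaleR algebra_simps)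
    then have "h (F u + B *v (c *\<^sub>R s)) \<le> (1 - c) * h (F u) + c * h (F u + B *v s)"
      using convex_onD[OF convex_h, of c "F u" "F u + B *v s"] c by simp
    moreover have "r * eta p \<Omega> h F r' u B = c * (h (F u) - h (F u + B *v s))"
      by (simp add: s(3) c_def)
    ultimately show ?thesis
      by (simp add: algebra_simps)
  qed
  ultimately show ?thesis
    using that by blast
qed

text \<open>The Taylor remainder and the finite-difference error each contribute at most
  \<open>L\<^sub>J / 2 * (c2p * r)\<^sup>2\<close>, the latter because \<open>t\<close> times the
  root of the dimension is at most \<open>r\<close>, hence at most \<open>c2p * r\<close>.\<close>

lemma model_error:
  assumes err: "\<And>v. norm ((B - J u) *v v) \<le> L\<^sub>J * sqrt (real CARD('n)) / 2 * t * norm v"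
    and t: "0 < t" "t * sqrt (real CARD('n)) \<le> r" and s: "pnorm p s \<le> r"
  shows "h (F (u + s)) - h (F u + B *v s) \<le> L * L\<^sub>J * cp2 * c2p\<^sup>2 * r\<^sup>2"
proof -
  have r: "0 \<le> r"
    using t by (meson less_imp_le mult_nonneg_nonneg of_nat_0_le_iff order_trans real_sqrt_ge_zero)
  have ns: "norm s \<le> c2p * r"
    using norm_le_pnorm[of s] s c2p_ge by (meson mult_left_mono order_trans zero_le_one)
  have ts: "sqrt (real CARD('n)) * t \<le> c2p * r"
    using t(2) mult_right_mono[OF c2p_ge r] by (simp add: mult.commute)
  have "norm (F (u + s) - (F u + B *v s))
      = norm ((F (u + s) - F u - J u *v s) - (B - J u) *v s)"
    by (simp add: matrix_vector_mult_diff_rdistrib algebra_simps)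
  also have "\<dots> \<le> L\<^sub>J / 2 * (norm s)\<^sup>2 + L\<^sub>J * sqrt (real CARD('n)) / 2 * t * norm s"
    by (intro norm_triangle_le_diff add_mono err jacobian_quadratic_remainder F_diff J_lipschitz)
  also have "\<dots> = L\<^sub>J / 2 * ((norm s)\<^sup>2 + (sqrt (real CARD('n)) * t) * norm s)"
    by (simp add: algebra_simps)
  also have "\<dots> \<le> L\<^sub>J / 2 * ((c2p * r)\<^sup>2 + (c2p * r) * (c2p * r))"
    using LJ_pos c2p_ge r by (intro mult_left_mono add_mono power_mono mult_mono[OF ts ns] ns) auto
  also have "\<dots> = L\<^sub>J * c2p\<^sup>2 * r\<^sup>2"
    by (simp add: power2_eq_square)
  finally have "L * cp2 * norm (F (u + s) - (F u + B *v s)) \<le> L * cp2 * (L\<^sub>J * c2p\<^sup>2 * r\<^sup>2)"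
    using L_pos cp2_ge by (intro mult_left_mono) auto
  then show ?thesis
    using h_lipschitz_norm[of "F (u + s)" "F u + B *v s"] by (simp add: mult_ac)
qed

section \<open>Transitions of a single iteration\<close>

lemma iteration: "trfd_iteration p \<Omega> h F \<epsilon> \<alpha> \<theta> \<Delta>s x \<Delta> \<tau> A d entry k"
  using run by (simp add: trfd_def)

lemma initial:
  "x 0 \<in> \<Omega>" "\<tau> 0 = \<epsilon> / (L * \<sigma> * cp2 * c2p * sqrt (real CARD('n)))" "\<tau> 0 * sqrt (real CARD('n)) \<le> \<Delta> 0" "\<Delta> 0 \<le> \<Delta>s"
  "entry 0 = Step1"
  using run by (auto simp: trfd_def trfd_init_def)

lemma model_step_iff: "model_step k \<longleftrightarrow> successful k \<or> rejected k"
  and not_successful_and_rejected: "\<not> (successful k \<and> rejected k)"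
  by (auto simp: successful_def rejected_def)

lemma successful_step:
  assumes "successful k"
  shows "x k + d k \<in> \<Omega>" "x (Suc k) = x k + d k" "\<Delta> (Suc k) = min (2 * \<Delta> k) \<Delta>s"
    "\<tau> (Suc k) = \<tau> k" "entry (Suc k) = Step1"
  using iteration[of k] assms
  by (auto simp: trfd_iteration_def successful_def actual_decrease_def model_decrease_def)

lemma not_successful_step: "\<not> successful k \<Longrightarrow> x (Suc k) = x k"
  using iteration[of k]
  by (auto simp: trfd_iteration_def successful_def actual_decrease_def model_decrease_def
      split: if_splits)

lemma rejected_step: "rejected k \<Longrightarrow> \<Delta> (Suc k) = \<Delta> k / 2"
  using iteration[of k]
  by (auto simp: trfd_iteration_def rejected_def actual_decrease_def model_decrease_def)

lemma not_model_step: "\<not> model_step k \<Longrightarrow> \<Delta> (Suc k) = \<Delta> k"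
  using iteration[of k] by (auto simp: trfd_iteration_def)

lemma halving_step: "halving k \<Longrightarrow> \<tau> (Suc k) = \<tau> k / 2 \<and> entry (Suc k) = Step1"
  using iteration[of k]
  by (auto simp: trfd_iteration_def halving_def rejected_def actual_decrease_def
      model_decrease_def split: if_splits)

lemma rejected_not_halving_step:
  assumes "rejected k" "\<not> halving k"
  shows "\<tau> (Suc k) = \<tau> k" "\<tau> k * sqrt (real CARD('n)) \<le> \<Delta> (Suc k)" "A (Suc k) = A k" "entry (Suc k) = Step3"
  using iteration[of k] assms
  by (auto simp: trfd_iteration_def halving_def rejected_def actual_decrease_def
      model_decrease_def split: if_splits)

lemma not_halving_step: "\<not> halving k \<Longrightarrow> \<tau> (Suc k) = \<tau> k"
  using rejected_not_halving_step(1) successful_step(4)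
  by (metis halving_def model_step_iff)

text \<open>Charges every matrix construction after the first to the iteration just before
  it.\<close>

lemma entry_Suc: "entry (Suc k) = Step1 \<longleftrightarrow> successful k \<or> halving k"
  using rejected_not_halving_step(4) successful_step(5) halving_step
  by (metis entry_step.distinct(1) halving_def model_step_iff)

lemma not_successful_and_halving: "\<not> (successful k \<and> halving k)"
  using not_successful_and_rejected by (auto simp: halving_def model_step_iff)

section \<open>The loop invariant\<close>

text \<open>An iteration entered at Step 3 neither rebuilds the matrix nor repeats the test on
  \<open>eta\<close>, so the accuracy of \<open>A k\<close> and the lower bound on
  \<open>eta\<close> must be carried along.\<close>

definition state_ok :: "nat \<Rightarrow> bool" where
  "state_ok k \<longleftrightarrow> x k \<in> \<Omega> \<and> 0 < \<tau> k \<and> \<tau> k * sqrt (real CARD('n)) \<le> \<Delta> k \<and> \<Delta> k \<le> \<Delta>s \<and>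
     (\<forall>v. norm ((A k - J (x k)) *v v) \<le> L\<^sub>J * sqrt (real CARD('n)) / 2 * \<tau> k * norm v) \<and>
     (model_step k \<longrightarrow> \<epsilon> / 2 \<le> eta p \<Omega> h F \<Delta>s (x k) (A k))"

lemma radius_pos: "state_ok k \<Longrightarrow> 0 < \<Delta> k"
  unfolding state_ok_def
  by (meson less_le_trans mult_pos_pos real_sqrt_gt_zero of_nat_0_less_iff zero_less_card_finite)

text \<open>With a fresh matrix the accuracy is the forward-difference bound, and reaching Step 3 is
  itself the test on \<open>eta\<close>.\<close>

lemma state_ok_Step1:
  assumes "entry k = Step1" "x k \<in> \<Omega>" "0 < \<tau> k" "\<tau> k * sqrt (real CARD('n)) \<le> \<Delta> k" "\<Delta> k \<le> \<Delta>s"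
  shows "state_ok k"
proof -
  have "\<And>j. column j (A k) = (F (x k + \<tau> k *\<^sub>R axis j 1) - F (x k)) /\<^sub>R \<tau> k"
    using iteration[of k] assms(1) by (auto simp: trfd_iteration_def)
  from forward_difference_jacobian_error[OF F_diff J_lipschitz assms(3) this]
  show ?thesis
    using assms by (auto simp: state_ok_def reaches_step3_def)
qed

lemma state_ok: "state_ok k"
proof (induction k)
  case 0
  have "0 < \<tau> 0"
    using initial eps_pos L_pos sigma_pos cp2_ge c2p_ge by simp
  then show ?case
    using initial by (intro state_ok_Step1)
next
  case (Suc k)
  then have k: "x k \<in> \<Omega>" "0 < \<tau> k" "\<tau> k * sqrt (real CARD('n)) \<le> \<Delta> k" "\<Delta> k \<le> \<Delta>s" "0 < \<Delta> k"
    using radius_pos by (auto simp: state_ok_def)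
  consider "successful k" | "\<not> model_step k" | "rejected k" "halving k" | "rejected k" "\<not> halving k"
    using model_step_iff by blast
  then show ?case
  proof cases
    case 1
    from successful_step[OF 1] k show ?thesis
      by (intro state_ok_Step1) auto
  next
    case 2
    then have "\<not> successful k" "halving k"
      by (auto simp: successful_def halving_def)
    then show ?thesis
      using not_successful_step k
      by (intro state_ok_Step1) (auto simp: halving_step not_model_step[OF 2])
  next
    \<comment> \<open>Radius and \<open>\<tau>\<close> are halved together, which preserves their
      inequality.\<close>
    case 3
    then have "\<not> successful k"
      using not_successful_and_rejected by blast
    then show ?thesis
      using not_successful_step 3 k
      by (intro state_ok_Step1) (auto simp: halving_step rejected_step)
  next
    \<comment> \<open>Iterate, matrix and \<open>\<tau>\<close> are unchanged, so accuracy and the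
      bound on \<open>eta\<close> are inherited; the test of Step 5 supplies the inequality for the
      halved radius.\<close>
    case 4
    then have "x (Suc k) = x k" "model_step k"
      using not_successful_step not_successful_and_rejected model_step_iff by blast+
    then show ?thesis
      using Suc rejected_not_halving_step[OF 4] rejected_step[OF 4(1)] k
      by (simp add: state_ok_def)
  qed
qed

lemma state:
  "x k \<in> \<Omega>" "0 < \<tau> k" "\<tau> k * sqrt (real CARD('n)) \<le> \<Delta> k" "0 < \<Delta> k" "\<Delta> k \<le> \<Delta>s"
  "norm ((A k - J (x k)) *v v) \<le> L\<^sub>J * sqrt (real CARD('n)) / 2 * \<tau> k * norm v"
  "model_step k \<Longrightarrow> \<epsilon> / 2 \<le> eta p \<Omega> h F \<Delta>s (x k) (A k)"
  using state_ok[of k] radius_pos[of k] by (auto simp: state_ok_def)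

section \<open>Sufficient decrease and acceptance of short steps\<close>

lemma trial_step:
  assumes "model_step k"
  obtains ds where "pnorm p (d k) \<le> \<Delta> k"
    "is_arg_min (\<lambda>u. h (F (x k) + A k *v u)) (\<lambda>u. pnorm p u \<le> \<Delta> k \<and> x k + u \<in> \<Omega>) ds"
    "\<theta> * (h (F (x k)) - h (F (x k) + A k *v ds)) \<le> model_decrease k"
  using iteration[of k] assms by (auto simp: trfd_iteration_def model_decrease_def)

text \<open>The scaled minimizer from radius \<open>\<Delta>s\<close> competes with the subproblem
  solution \<open>ds\<close>, of whose decrease the trial step achieves at least the fraction
  \<theta>.\<close>

lemma model_decrease_ge:
  assumes "model_step k"
  shows "\<theta> * \<Delta> k * \<epsilon> / 2 \<le> model_decrease k"
proof -
  obtain s where s: "x k + s \<in> \<Omega>" "pnorm p s \<le> \<Delta> k"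
    "\<Delta> k * eta p \<Omega> h F \<Delta>s (x k) (A k) \<le> h (F (x k)) - h (F (x k) + A k *v s)"
    using model_decrease_scaled[OF state(1) state(4) state(5)] .
  obtain ds where
    "is_arg_min (\<lambda>u. h (F (x k) + A k *v u)) (\<lambda>u. pnorm p u \<le> \<Delta> k \<and> x k + u \<in> \<Omega>) ds"
    and ds: "\<theta> * (h (F (x k)) - h (F (x k) + A k *v ds)) \<le> model_decrease k"
    using trial_step[OF assms] .
  then have "h (F (x k) + A k *v ds) \<le> h (F (x k) + A k *v s)"
    using s by (auto simp: is_arg_min_linorder)
  moreover have "\<Delta> k * (\<epsilon> / 2) \<le> \<Delta> k * eta p \<Omega> h F \<Delta>s (x k) (A k)"
    using state(4)[of k] state(7)[OF assms] by (intro mult_left_mono) auto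
  ultimately have "\<Delta> k * (\<epsilon> / 2) \<le> h (F (x k)) - h (F (x k) + A k *v ds)"
    using s(3) by linarith
  then have "\<theta> * (\<Delta> k * (\<epsilon> / 2)) \<le> \<theta> * (h (F (x k)) - h (F (x k) + A k *v ds))"
    using theta_pos by (intro mult_left_mono) auto
  also note ds
  finally show ?thesis
    by (simp add: mult_ac)
qed

lemma model_decrease_pos: "model_step k \<Longrightarrow> 0 < model_decrease k"
  using model_decrease_ge[of k] state(4)[of k] theta_pos eps_pos
  by (meson divide_pos_pos less_le_trans mult_pos_pos zero_less_numeral)

lemma successful_if_small_radius:
  assumes "model_step k" and small: "\<Delta> k \<le> 2 * radius_min"
  shows "successful k"
proof -
  have m: "0 < model_decrease k"
    by (rule model_decrease_pos[OF assms(1)])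
  have "model_decrease k - actual_decrease k = h (F (x k + d k)) - h (F (x k) + A k *v d k)"
    by (simp add: model_decrease_def actual_decrease_def)
  also have "\<dots> \<le> L * L\<^sub>J * cp2 * c2p\<^sup>2 * (\<Delta> k)\<^sup>2"
  proof (rule model_error[OF state(6) state(2,3)])
    show "pnorm p (d k) \<le> \<Delta> k"
      using trial_step[OF assms(1)] .
  qed
  \<comment> \<open>Only one factor \<open>\<Delta> k\<close> is replaced by the threshold; the
    other one matches the linear lower bound on the model decrease.\<close>
  also have "\<dots> \<le> L * lip_max * cp2 * c2p\<^sup>2 * (\<Delta> k * (2 * radius_min))"
    unfolding power2_eq_square[of "\<Delta> k"]
    using small state(4)[of k] L_pos LJ_pos cp2_ge by (intro mult_mono) auto
  also have "\<dots> = (1 - \<alpha>) * (\<theta> * \<Delta> k * \<epsilon> / 2)"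
    using L_pos lip_max_pos cp2_ge c2p_ge by (simp add: radius_min_def)
  also have "\<dots> \<le> (1 - \<alpha>) * model_decrease k"
    using alpha_less by (intro mult_left_mono model_decrease_ge assms(1)) auto
  finally have "\<alpha> * model_decrease k \<le> actual_decrease k"
    by (simp add: algebra_simps)
  with m assms(1) show ?thesis
    by (simp add: successful_def le_divide_eq)
qed

section \<open>Lower bounds for the radius and the difference parameter\<close>

text \<open>The ratio on the right is the argument of the first logarithm in the final
  bound.\<close>

lemma tau_0_radius_min:
  "\<tau> 0 * sqrt (real CARD('n)) = 4 * lip_max * c2p / (\<sigma> * (1 - \<alpha>) * \<theta>) * radius_min"
  using L_pos lip_max_pos cp2_ge c2p_ge sigma_pos alpha_less theta_pos
  by (simp add: initial(2) radius_min_def power2_eq_square)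

lemma tau_ratio_ge: "4 \<le> 4 * lip_max * c2p / (\<sigma> * (1 - \<alpha>) * \<theta>)"
proof -
  have "\<sigma> * ((1 - \<alpha>) * \<theta>) \<le> lip_max * (1 * c2p)"
    using alpha_pos alpha_less theta_pos theta_le c2p_ge sigma_pos by (intro mult_mono) auto
  then show ?thesis
    using sigma_pos alpha_less theta_pos by (simp add: le_divide_eq algebra_simps)
qed

lemma radius_min_le_radius: "radius_min \<le> \<Delta> k"
proof (induction k)
  case 0
  have "4 * radius_min \<le> \<tau> 0 * sqrt (real CARD('n))"
    unfolding tau_0_radius_min using radius_min_pos by (intro mult_right_mono tau_ratio_ge) auto
  then show ?case
    using initial(3) radius_min_pos by linarith
next
  case (Suc k)
  consider "successful k" | "\<not> model_step k" | "rejected k"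
    using model_step_iff by blast
  then show ?case
  proof cases
    \<comment> \<open>Truncation at \<open>\<Delta>s\<close> is harmless, since
      \<open>\<Delta>s\<close> is at least \<open>\<Delta> k\<close>.\<close>
    case 1
    then show ?thesis
      using Suc state(4,5)[of k] successful_step(3) by auto
  next
    case 2
    then show ?thesis
      using Suc not_model_step by simp
  next
    \<comment> \<open>A rejected step has radius above the acceptance threshold, so its half is
      still large enough.\<close>
    case 3
    then have "2 * radius_min < \<Delta> k"
      using successful_if_small_radius not_successful_and_rejected model_step_iff
      by (meson not_le)
    then show ?thesis
      using rejected_step[OF 3] by simp
  qed
qed

text \<open>Here \<open>eta\<close> is below \<epsilon>/2 and \<open>psi\<close> above \<epsilon>,
  so the finite-difference error must account for a gap of \<epsilon>/2; that error is proportional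
  to \<open>\<tau> k\<close>.\<close>

lemma tau_ge_if_not_model_step:
  assumes "\<not> model_step k" "\<epsilon> < psi p \<Omega> h F \<Delta>s (x k)"
  shows "radius_min \<le> \<tau> k * sqrt (real CARD('n))"
proof -
  let ?t = "\<tau> k * sqrt (real CARD('n))"
  have c: "0 < L * lip_max * cp2 * c2p"
    using L_pos lip_max_pos cp2_ge c2p_ge by simp
  have t: "0 < ?t"
    using state(2)[of k] by simp
  have "0 < \<Delta>s"
    using state(4,5)[of k] by linarith
  then have "psi p \<Omega> h F \<Delta>s (x k) \<le> eta p \<Omega> h F \<Delta>s (x k) (A k)
      + L * cp2 * c2p * (L\<^sub>J * sqrt (real CARD('n)) / 2 * \<tau> k)"
    using state(1) state(6) by (intro psi_le_eta)
  also have "\<dots> \<le> \<epsilon> / 2 + L * cp2 * c2p * (L\<^sub>J * sqrt (real CARD('n)) / 2 * \<tau> k)"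
    using assms(1) by (simp add: reaches_step3_def)
  finally have "\<epsilon> \<le> L * L\<^sub>J * cp2 * c2p * ?t"
    using assms(2) by (simp add: mult_ac)
  also have "\<dots> \<le> L * lip_max * cp2 * c2p * ?t"
    using t L_pos LJ_pos cp2_ge c2p_ge by (intro mult_right_mono mult_left_mono) auto
  finally have "\<epsilon> / (L * lip_max * cp2 * c2p) \<le> ?t"
    using c by (simp add: divide_le_eq mult_ac)
  moreover have "radius_min \<le> \<epsilon> / (L * lip_max * cp2 * c2p) / 4"
    using radius_min_le by (simp add: mult_ac)
  ultimately have "radius_min \<le> ?t / 4"
    by (meson divide_right_mono order_trans zero_le_numeral)
  also have "\<dots> \<le> ?t"
    using t by simp
  finally show ?thesis .
qed

text \<open>Every halving starts from a value of at least \<open>radius_min\<close>, hence the lost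
  factor 2.\<close>

lemma tau_ge:
  assumes "\<And>k. k < N \<Longrightarrow> \<epsilon> < psi p \<Omega> h F \<Delta>s (x k)"
  shows "radius_min / 2 \<le> \<tau> N * sqrt (real CARD('n))"
  using assms
proof (induction N)
  case 0
  have "4 * radius_min \<le> \<tau> 0 * sqrt (real CARD('n))"
    unfolding tau_0_radius_min using radius_min_pos by (intro mult_right_mono tau_ratio_ge) auto
  then show ?case
    using radius_min_pos by linarith
next
  case (Suc N)
  show ?case
  proof (cases "halving N")
    case True
    have "radius_min \<le> \<tau> N * sqrt (real CARD('n))"
    \<comment> \<open>The halving happens at Step 5 in the first case, where the new radius lies
      below the old value, and at Step 2 in the second.\<close>
    proof (cases "model_step N")
      case True
      with \<open>halving N\<close> show ?thesis
        using radius_min_le_radius[of "Suc N"] by (auto simp: halving_def)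
    next
      case False
      with Suc.prems show ?thesis
        by (intro tau_ge_if_not_model_step) auto
    qed
    then show ?thesis
      by (simp add: halving_step[OF True])
  next
    case False
    with Suc show ?thesis
      using not_halving_step by simp
  qed
qed

section \<open>Counting iterations and evaluations\<close>

text \<open>A sum of truth values rather than a cardinality, so that inductions on \<open>N\<close>
  unfold one iteration at a time.\<close>

definition iterations_before :: "(nat \<Rightarrow> bool) \<Rightarrow> nat \<Rightarrow> nat" where
  "iterations_before P N = (\<Sum>k<N. of_bool (P k))"

lemma iterations_before_simps [simp]:
  "iterations_before P 0 = 0"
  "iterations_before P (Suc N) = iterations_before P N + of_bool (P N)"
  by (simp_all add: iterations_before_def)

abbreviation "S \<equiv> iterations_before successful"
abbreviation "R \<equiv> iterations_before rejected"
abbreviation "H \<equiv> iterations_before halving"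

text \<open>Only an inequality, because a rejected iteration that halves \<open>\<tau>\<close> is
  counted twice.\<close>

lemma iteration_count: "N \<le> S N + R N + H N"
  by (induction N) (auto simp: halving_def model_step_iff)

lemma F_evals_le:
  "F_evals p \<Omega> h F \<epsilon> \<Delta>s x A entry N \<le> 1 + CARD('n) * (1 + S N + H N) + S N + R N"
proof -
  have "iterations_before (\<lambda>k. entry k = Step1) N \<le> 1 + S N + H N"
  \<comment> \<open>A construction is caused by the preceding iteration, so the count before
    \<open>Suc M\<close> is governed by the events before \<open>M\<close>, plus the initial
    construction.\<close>
  proof (cases N)
    case (Suc M)
    have "iterations_before (\<lambda>k. entry k = Step1) (Suc M) = 1 + S M + H M"
      using not_successful_and_halving
      by (induction M) (auto simp: initial(5) entry_Suc of_bool_def)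
    with Suc show ?thesis
      by simp
  qed simp
  moreover have "iterations_before model_step N = S N + R N"
    using not_successful_and_rejected by (induction N) (auto simp: model_step_iff of_bool_def)
  moreover have "F_evals p \<Omega> h F \<epsilon> \<Delta>s x A entry N
      = 1 + (CARD('n) * iterations_before (\<lambda>k. entry k = Step1) N + iterations_before model_step N)"
    unfolding F_evals_def iterations_before_def sum_distrib_left sum.distrib[symmetric]
    by (intro arg_cong2[of _ _ _ _ "(+)"] refl sum.cong) auto
  ultimately show ?thesis
    by (simp add: mult_le_mono2 del: mult_Suc_right)
qed

text \<open>Telescoping: a success gains at least \<alpha> times the model decrease, and all other
  iterations keep the iterate.\<close>

lemma objective_decrease:
  "S N * (\<alpha> * (\<theta> * radius_min * \<epsilon> / 2)) \<le> h (F (x 0)) - h (F (x N))"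
proof (induction N)
  case (Suc N)
  show ?case
  proof (cases "successful N")
    case True
    then have m: "model_step N" "\<alpha> \<le> actual_decrease N / model_decrease N"
      by (auto simp: successful_def)
    have "\<theta> * radius_min * \<epsilon> / 2 \<le> \<theta> * \<Delta> N * \<epsilon> / 2"
      using theta_pos eps_pos
      by (intro divide_right_mono mult_right_mono mult_left_mono radius_min_le_radius) auto
    also have "\<dots> \<le> model_decrease N"
      by (rule model_decrease_ge[OF m(1)])
    finally have "\<alpha> * (\<theta> * radius_min * \<epsilon> / 2) \<le> \<alpha> * model_decrease N"
      using alpha_pos by (intro mult_left_mono) auto
    also have "\<dots> \<le> actual_decrease N"
      using m(2) model_decrease_pos[OF m(1)] by (simp add: le_divide_eq)
    finally show ?thesis
      using Suc True successful_step(2)[OF True]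
      by (simp add: actual_decrease_def distrib_right)
  next
    case False
    with Suc show ?thesis
      using not_successful_step by simp
  qed
qed simp

text \<open>Equality can fail only through the cap \<open>\<Delta>s\<close> on doubling.\<close>

lemma radius_bound: "\<Delta> N * 2 ^ R N \<le> \<Delta> 0 * 2 ^ S N"
proof (induction N)
  case (Suc N)
  consider "successful N" "\<not> rejected N" | "\<not> model_step N" | "rejected N" "\<not> successful N"
    using model_step_iff not_successful_and_rejected by blast
  then show ?case
  proof cases
    case 1
    have "\<Delta> (Suc N) * 2 ^ R N \<le> 2 * \<Delta> N * 2 ^ R N"
      by (intro mult_right_mono) (auto simp: successful_step(3)[OF 1(1)])
    also have "\<dots> \<le> 2 * (\<Delta> 0 * 2 ^ S N)"
      using Suc by simp
    finally show ?thesis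
      using 1 by simp
  next
    case 2
    then show ?thesis
      using Suc by (simp add: not_model_step model_step_iff)
  next
    case 3
    then show ?thesis
      using Suc by (simp add: rejected_step)
  qed
qed simp

lemma tau_halvings: "\<tau> N * 2 ^ H N = \<tau> 0"
  by (induction N) (auto simp: halving_step not_halving_step)

lemma successful_count:
  "S N \<le> 8 * L * lip_max * cp2 * c2p\<^sup>2 * (h (F (x 0)) - f_low) / (\<alpha> * (1 - \<alpha>) * \<theta>\<^sup>2) / \<epsilon>\<^sup>2"
proof -
  have "S N * (\<alpha> * (\<theta> * radius_min * \<epsilon> / 2)) \<le> h (F (x 0)) - f_low"
    using objective_decrease[of N] f_ge[of "x N"] by linarith
  moreover have "0 < \<alpha> * (\<theta> * radius_min * \<epsilon> / 2)"
    using alpha_pos theta_pos radius_min_pos eps_pos by simp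
  ultimately have "S N \<le> (h (F (x 0)) - f_low) / (\<alpha> * (\<theta> * radius_min * \<epsilon> / 2))"
    by (simp add: le_divide_eq)
  \<comment> \<open>The 8 is the 4 in \<open>radius_min\<close> times the 2 from
    \<epsilon>/2.\<close>
  also have "\<dots> = 8 * L * lip_max * cp2 * c2p\<^sup>2 * (h (F (x 0)) - f_low)
      / (\<alpha> * (1 - \<alpha>) * \<theta>\<^sup>2) / \<epsilon>\<^sup>2"
    by (simp add: radius_min_def power2_eq_square mult_ac)
  finally show ?thesis .
qed

text \<open>Logarithm of \<open>radius_bound\<close>, with the final radius bounded below by
  \<open>radius_min\<close>.\<close>

lemma rejected_count: "R N \<le> S N + log 2 (\<Delta> 0 / radius_min)"
proof -
  have "radius_min * 2 ^ R N \<le> \<Delta> 0 * 2 ^ S N"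
    using radius_bound[of N] mult_right_mono[OF radius_min_le_radius[of N], of "2 ^ R N"]
    by (meson order_trans zero_le_numeral zero_le_power)
  then have "2 ^ R N \<le> 2 ^ S N * (\<Delta> 0 / radius_min)"
    using radius_min_pos by (simp add: le_divide_eq mult_ac)
  then have "log 2 (2 ^ R N) \<le> log 2 (2 ^ S N * (\<Delta> 0 / radius_min))"
    by (intro log_mono) auto
  also have "\<dots> = S N + log 2 (\<Delta> 0 / radius_min)"
    using radius_min_pos state(4)[of 0] by (subst log_mult) (auto simp: log_nat_power)
  finally show ?thesis
    by (simp add: log_nat_power)
qed

text \<open>Logarithm of \<open>tau_halvings\<close>; the summand 1 is the factor 2 lost in
  \<open>tau_ge\<close>.\<close>

lemma halving_count:
  assumes "\<And>k. k < N \<Longrightarrow> \<epsilon> < psi p \<Omega> h F \<Delta>s (x k)"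
  shows "H N \<le> 1 + log 2 (4 * lip_max * c2p / (\<sigma> * (1 - \<alpha>) * \<theta>))"
proof -
  let ?Q = "4 * lip_max * c2p / (\<sigma> * (1 - \<alpha>) * \<theta>)"
  have "radius_min / 2 * 2 ^ H N \<le> \<tau> N * sqrt (real CARD('n)) * 2 ^ H N"
    using assms by (intro mult_right_mono tau_ge) auto
  also have "\<dots> = ?Q * radius_min"
    unfolding tau_0_radius_min[symmetric] using tau_halvings[of N] by (simp add: mult_ac)
  finally have "2 ^ H N * radius_min \<le> 2 * ?Q * radius_min"
    by (simp add: mult_ac)
  then have "2 ^ H N \<le> 2 * ?Q"
    using radius_min_pos by (rule mult_right_le_imp_le)
  then have "log 2 (2 ^ H N) \<le> log 2 (2 * ?Q)"
    by (intro log_mono) auto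
  also have "\<dots> = 1 + log 2 ?Q"
    using tau_ratio_ge by (subst log_mult) auto
  finally show ?thesis
    by (simp add: log_nat_power)
qed

text \<open>Lets the radius logarithm absorb the extra 1 of \<open>halving_count\<close> in the
  final estimate.\<close>

lemma radius_ratio_ge: "1 \<le> log 2 (\<Delta> 0 / radius_min)"
proof -
  have "4 * radius_min \<le> \<tau> 0 * sqrt (real CARD('n))"
    unfolding tau_0_radius_min using radius_min_pos by (intro mult_right_mono tau_ratio_ge) auto
  then have "2 \<le> \<Delta> 0 / radius_min"
    using initial(3) radius_min_pos by (simp add: le_divide_eq)
  then have "log 2 2 \<le> log 2 (\<Delta> 0 / radius_min)"
    by (subst log_le_cancel_iff) auto
  then show ?thesis
    by simp
qed

section \<open>Finite termination and the evaluation bound\<close>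

text \<open>Otherwise the three counts would bound every natural number by one fixed real.\<close>

lemma exists_small_psi: "\<exists>k. psi p \<Omega> h F \<Delta>s (x k) \<le> \<epsilon>"
proof (rule ccontr)
  let ?S = "8 * L * lip_max * cp2 * c2p\<^sup>2 * (h (F (x 0)) - f_low) / (\<alpha> * (1 - \<alpha>) * \<theta>\<^sup>2) / \<epsilon>\<^sup>2"
  let ?H = "1 + log 2 (4 * lip_max * c2p / (\<sigma> * (1 - \<alpha>) * \<theta>))"
  assume "\<nexists>k. psi p \<Omega> h F \<Delta>s (x k) \<le> \<epsilon>"
  then have psi: "\<epsilon> < psi p \<Omega> h F \<Delta>s (x k)" for k
    by (meson not_le)
  have "real N \<le> 2 * ?S + log 2 (\<Delta> 0 / radius_min) + ?H" for N
  proof -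
    have "real N \<le> real (S N) + real (R N) + real (H N)"
      using iteration_count[of N] by (simp flip: of_nat_add)
    then show ?thesis
      using successful_count[of N] rejected_count[of N] halving_count[OF psi, of N]
      by linarith
  qed
  then show False
    by (meson not_le reals_Archimedean2)
qed

text \<open>The number of matrices, and the number of trial points plus the initial evaluation, are
  each at most the bracket. Its constant 16 is twice 8 because rejections may again be as many as
  successes.\<close>

lemma F_evals_bound:
  assumes "\<And>k. k < N \<Longrightarrow> \<epsilon> < psi p \<Omega> h F \<Delta>s (x k)"
  shows "real (F_evals p \<Omega> h F \<epsilon> \<Delta>s x A entry N) \<le>
      (real CARD('n) + 1) *
        (16 * L * max \<sigma> L\<^sub>J * cp2 * c2p\<^sup>2 * (h (F (x 0)) - f_low) / (\<alpha> * (1 - \<alpha>) * \<theta>\<^sup>2) * \<epsilon> powi (-2)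
         + of_int \<lceil>\<bar>log 2 (4 * max \<sigma> L\<^sub>J * c2p / (\<sigma> * (1 - \<alpha>) * \<theta>))\<bar>\<rceil>
         + log 2 (4 * L * max \<sigma> L\<^sub>J * cp2 * c2p\<^sup>2 * \<Delta> 0 / ((1 - \<alpha>) * \<theta>) * \<epsilon> powi (-1))
         + 1)"
proof -
  let ?n = "real CARD('n)"
  define T where "T = 8 * L * lip_max * cp2 * c2p\<^sup>2 * (h (F (x 0)) - f_low)
      / (\<alpha> * (1 - \<alpha>) * \<theta>\<^sup>2) / \<epsilon>\<^sup>2"
  define C :: real where "C = of_int \<lceil>\<bar>log 2 (4 * lip_max * c2p / (\<sigma> * (1 - \<alpha>) * \<theta>))\<bar>\<rceil>"
  define G where "G = log 2 (\<Delta> 0 / radius_min)"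
  have powi: "\<epsilon> powi (-1) = 1 / \<epsilon>" "\<epsilon> powi (-2) = 1 / \<epsilon>\<^sup>2"
    by (simp_all add: power_int_def inverse_eq_divide power_one_over)
  have T2: "2 * T = 16 * L * lip_max * cp2 * c2p\<^sup>2 * (h (F (x 0)) - f_low)
      / (\<alpha> * (1 - \<alpha>) * \<theta>\<^sup>2) * \<epsilon> powi (-2)"
    by (simp add: T_def powi)
  have G_eq: "G = log 2 (4 * L * lip_max * cp2 * c2p\<^sup>2 * \<Delta> 0 / ((1 - \<alpha>) * \<theta>) * \<epsilon> powi (-1))"
    by (simp add: G_def radius_min_def powi inverse_eq_divide mult_ac)
  have T: "real (S N) \<le> T"
    unfolding T_def by (rule successful_count)
  have R: "real (R N) \<le> real (S N) + G"
    unfolding G_def by (rule rejected_count)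
  have H: "real (H N) \<le> 1 + C"
    using halving_count[OF assms] unfolding C_def
    by (meson abs_ge_self add_left_mono le_of_int_ceiling order_trans)
  have G: "1 \<le> G"
    unfolding G_def by (rule radius_ratio_ge)
  have C: "0 \<le> C"
    by (simp add: C_def)
  have T0: "0 \<le> T"
    using T by (meson of_nat_0_le_iff order_trans)
  have "real (F_evals p \<Omega> h F \<epsilon> \<Delta>s x A entry N)
      \<le> real (1 + CARD('n) * (1 + S N + H N) + S N + R N)"
    using F_evals_le[of N] by (intro of_nat_mono)
  also have "\<dots> = 1 + ?n * (1 + S N + H N) + S N + R N"
    by (simp add: algebra_simps)
  also have "\<dots> \<le> 1 + ?n * (2 * T + C + G + 1) + 2 * T + G"
  proof -
    \<comment> \<open>Here \<open>1 \<le> G\<close> pays for the additional halving.\<close>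
    have "?n * (1 + S N + H N) \<le> ?n * (2 * T + C + G + 1)"
      using T H G T0 by (intro mult_left_mono) auto
    then show ?thesis
      using T R by linarith
  qed
  also have "\<dots> \<le> (?n + 1) * (2 * T + C + G + 1)"
    using C by (simp add: algebra_simps)
  finally show ?thesis
    unfolding T2 G_eq C_def .
qed

end

text \<open>Turns the infimum in \<open>T_g\<close> into a least index, so that \<open>psi\<close>
  exceeds \<epsilon> at all earlier iterations.\<close>

lemma Inf_enat_Collect:
  assumes "P k"
  shows "Inf {enat k | k. P k} = enat (LEAST k. P k)"
proof (rule Inf_eqI)
  show "enat (LEAST k. P k) \<le> i" if "i \<in> {enat k | k. P k}" for i
    using that by (auto intro: Least_le)
  show "y \<le> enat (LEAST k. P k)" if "\<And>i. i \<in> {enat k | k. P k} \<Longrightarrow> y \<le> i" for y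
    using that LeastI[of P, OF assms] by blast
qed

theorem corollary3p9:
  fixes \<Omega> :: "(real ^ 'n) set"
    and F :: "real ^ 'n \<Rightarrow> real ^ 'm"
    and h :: "real ^ 'm \<Rightarrow> real"
    and p :: enat
    and L L\<^sub>J c2p cp2 f_low \<epsilon> \<sigma> \<alpha> \<theta> \<Delta>s :: real
    and x d :: "nat \<Rightarrow> real ^ 'n"
    and \<Delta> \<tau> :: "nat \<Rightarrow> real"
    and A :: "nat \<Rightarrow> real ^ 'n ^ 'm"
    and entry :: "nat \<Rightarrow> entry_step"
  assumes "p \<ge> 1"
    and "c2p \<ge> 1" and "\<And>u :: real ^ 'n. norm u \<le> c2p * pnorm p u"
    and "cp2 \<ge> 1" and "\<And>z :: real ^ 'm. pnorm p z \<le> cp2 * norm z"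
    and "L > 0" and "L\<^sub>J > 0"
    and "\<Omega> \<noteq> {}" and "closed \<Omega>" and "convex \<Omega>"
    and "\<And>u. F differentiable (at u)"
    and "\<And>u v. spectral_norm (jacobian F (at u) - jacobian F (at v)) \<le> L\<^sub>J * norm (u - v)"
    and "convex_on UNIV h"
    and "\<And>z w. \<bar>h z - h w\<bar> \<le> L * pnorm p (z - w)"
    and "\<And>u. h (F u) \<ge> f_low"
    and "\<epsilon> > 0" and "\<sigma> > 0" and "0 < \<alpha>" and "\<alpha> < 1" and "0 < \<theta>" and "\<theta> \<le> 1"
    and "trfd p \<Omega> h F L cp2 c2p \<epsilon> \<sigma> \<alpha> \<theta> \<Delta>s x \<Delta> \<tau> A d entry"
  shows "T_g p \<Omega> h F \<epsilon> \<Delta>s x \<noteq> \<infinity> \<and>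
    real (F_evals p \<Omega> h F \<epsilon> \<Delta>s x A entry (the_enat (T_g p \<Omega> h F \<epsilon> \<Delta>s x))) \<le>
      (real CARD('n) + 1) *
        (16 * L * max \<sigma> L\<^sub>J * cp2 * c2p\<^sup>2 * (h (F (x 0)) - f_low) / (\<alpha> * (1 - \<alpha>) * \<theta>\<^sup>2) * \<epsilon> powi (-2)
         + of_int \<lceil>\<bar>log 2 (4 * max \<sigma> L\<^sub>J * c2p / (\<sigma> * (1 - \<alpha>) * \<theta>))\<bar>\<rceil>
         + log 2 (4 * L * max \<sigma> L\<^sub>J * cp2 * c2p\<^sup>2 * \<Delta> 0 / ((1 - \<alpha>) * \<theta>) * \<epsilon> powi (-1))
         + 1)"
proof -
  interpret trfd_run \<Omega> F h p L L\<^sub>J c2p cp2 f_low \<epsilon> \<sigma> \<alpha> \<theta> \<Delta>s x d \<Delta> \<tau> A entry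
    by (unfold_locales; fact assms)
  let ?T = "LEAST k. psi p \<Omega> h F \<Delta>s (x k) \<le> \<epsilon>"
  have "T_g p \<Omega> h F \<epsilon> \<Delta>s x = enat ?T"
    using exists_small_psi by (auto simp: T_g_def intro: Inf_enat_Collect)
  moreover have "\<epsilon> < psi p \<Omega> h F \<Delta>s (x k)" if "k < ?T" for k
    using not_less_Least[OF that] by simp
  ultimately show ?thesis
    using F_evals_bound[of ?T] by simp
qed

end
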